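(* Let $A\in\mathbb{R}^{m\times d}$, $A\neq0$, and $b\in\mathbb{R}^m$ be arbitrary. Let $(v^k)_{k\ge0}$ be generated by the SGDAS iteration (described in the context), with random directions satisfying the isotropy assumption with constant $c$, and with constant stepsize $$\tau_k=\tau:=\frac{1}{c\|A\|^2}.$$ Then for every integer $N\ge1$ $$\min_{0\le k\le N-1}\mathbb{E}\big(\|A^T(Av^k-b)\|^2\big)\le\frac{c\|A\|^2\|b\|^2}{N}.$$
   Context: $\|\cdot\|$ is the Euclidean norm for vectors and the corresponding operator (spectral) norm for matrices. Isotropy assumption on the random direction $x\in\mathbb{R}^d$: $\mathbb{E}(xx^T)=I_d$ and $\mathbb{E}(xx^T\|x\|^2)=c\,I_d$ for some constant $c$. SGDAS: $v^0=0\in\mathbb{R}^d$ and, for $k=0,1,2,\dots$, draw a random vector $x=x^k$ (independent of the previous draws, with fixed distribution) and set $v^{k+1}=v^k-\tau_k\langle Av^k-b,Ax\rangle x$. $\mathbb{E}$ is the expectation over all involved randomness. *)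

theory Defs
  imports "HOL-Probability.Probability"
begin

definition outer :: "real ^ 'd \<Rightarrow> real ^ 'd \<Rightarrow> real ^ 'd ^ 'd" where
  "outer x y = (\<chi> i j. x $ i * y $ j)"

text \<open>Integrability is required explicitly: a Bochner integral that does not exist is \<open>0\<close> by
  convention, so that the last equation would otherwise admit \<open>c = 0\<close> for a distribution without
  fourth moments.\<close>

definition isotropic :: "(real ^ 'd) measure \<Rightarrow> real \<Rightarrow> bool" where
  "isotropic D c \<longleftrightarrow>
     integrable D (\<lambda>x. outer x x) \<and>
     integral\<^sup>L D (\<lambda>x. outer x x) = mat 1 \<and>
     integrable D (\<lambda>x. (norm x)\<^sup>2 *\<^sub>R outer x x) \<and>
     integral\<^sup>L D (\<lambda>x. (norm x)\<^sup>2 *\<^sub>R outer x x) = c *\<^sub>R mat 1"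

text \<open>The SGDAS iterates for one realization \<open>x\<close> of the sequence of random directions.\<close>

primrec sgdas ::
  "real ^ 'd ^ 'm \<Rightarrow> real ^ 'm \<Rightarrow> (nat \<Rightarrow> real) \<Rightarrow> (nat \<Rightarrow> real ^ 'd) \<Rightarrow> nat \<Rightarrow> real ^ 'd" where
  "sgdas A b \<tau> x 0 = 0"
| "sgdas A b \<tau> x (Suc k) =
     sgdas A b \<tau> x k - (\<tau> k * ((A *v sgdas A b \<tau> x k - b) \<bullet> (A *v x k))) *\<^sub>R x k"

text \<open>The type class norm on \<open>real ^ 'd ^ 'm\<close> is the Frobenius norm, hence the use of \<open>onorm\<close>.\<close>

definition spectral_norm :: "real ^ 'd ^ 'm \<Rightarrow> real" where
  "spectral_norm A = onorm ((*v) A)"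

end

theory Submission
  imports Defs
begin

text \<open>
  Write \<open>r = A v - b\<close> for the residual and \<open>g = A\<^sup>T r\<close> for the gradient of \<open>\<parallel>A v - b\<parallel>\<^sup>2 / 2\<close>. Since
  \<open>r \<bullet> A x = g \<bullet> x\<close>, one step replaces \<open>r\<close> by \<open>r - \<tau> (g \<bullet> x) A x\<close>, so that expanding the square and
  using \<open>\<parallel>A x\<parallel> \<le> \<parallel>A\<parallel> \<parallel>x\<parallel>\<close> bounds the new squared residual by
  \<open>\<parallel>r\<parallel>\<^sup>2 - 2 \<tau> (g \<bullet> x)\<^sup>2 + \<tau>\<^sup>2 \<parallel>A\<parallel>\<^sup>2 \<parallel>x\<parallel>\<^sup>2 (g \<bullet> x)\<^sup>2\<close> (\<open>residual_step_bound\<close>).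

  The direction \<open>x\<close> is independent of the current iterate, hence of \<open>g\<close>, and isotropy evaluates
  the two quadratic forms: \<open>E (g \<bullet> x)\<^sup>2 = E \<parallel>g\<parallel>\<^sup>2\<close> and \<open>E \<parallel>x\<parallel>\<^sup>2 (g \<bullet> x)\<^sup>2 = c E \<parallel>g\<parallel>\<^sup>2\<close>
  (\<open>indep_quadratic_form\<close>). The expected squared residual thus drops by at least
  \<open>(2 \<tau> - \<tau>\<^sup>2 c \<parallel>A\<parallel>\<^sup>2) E \<parallel>g\<parallel>\<^sup>2\<close> in each step (\<open>expected_residual_step\<close>). The stepsize
  \<open>\<tau> = 1 / (c \<parallel>A\<parallel>\<^sup>2)\<close> maximizes this factor, whose value is then \<open>\<tau>\<close> itself.

  The squared residual starts at \<open>\<parallel>b\<parallel>\<^sup>2\<close> and stays nonnegative, so the sum of all these drops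
  is at most \<open>\<parallel>b\<parallel>\<^sup>2\<close>; the smallest of \<open>N\<close> expected squared gradients is at most their average,
  which is therefore at most \<open>\<parallel>b\<parallel>\<^sup>2 / (\<tau> N)\<close>. Dividing by \<open>\<tau>\<close> requires \<open>c > 0\<close>, which isotropy
  entails (\<open>isotropic_const_ge_1\<close>).
\<close>

lemma inner_transpose_mult:
  fixes A :: "real ^ 'd ^ 'm"
  shows "(transpose A *v r) \<bullet> x = r \<bullet> (A *v x)"
  by (simp add: dot_lmul_matrix)

lemma borel_measurable_matrix_vector_mult [measurable (raw)]:
  fixes A :: "real ^ 'd ^ 'm"
  assumes "f \<in> borel_measurable M"
  shows "(\<lambda>\<omega>. A *v f \<omega>) \<in> borel_measurable M"
  by (rule borel_measurable_continuous_on[OF _ assms])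
     (simp add: linear_continuous_on matrix_vector_mul_bounded_linear)

lemma norm_matrix_vector_le_spectral:
  "norm (A *v x) \<le> spectral_norm A * norm x"
  unfolding spectral_norm_def by (rule onorm) simp

lemma spectral_norm_pos:
  fixes A :: "real ^ 'd ^ 'm"
  assumes "A \<noteq> 0"
  shows "spectral_norm A > 0"
proof -
  have "\<exists>x. A *v x \<noteq> 0"
    using assms by (metis matrix_eq matrix_vector_mult_0)
  then show ?thesis
    unfolding spectral_norm_def by (subst onorm_pos_lt) auto
qed

lemma outer_quadratic_form: "g \<bullet> (outer x x *v g) = (g \<bullet> x)\<^sup>2"
  by (simp add: outer_def inner_vec_def matrix_vector_mult_def power2_eq_square
      sum_product sum_distrib_left mult_ac)

lemma measurable_outer [measurable]: "(\<lambda>x. outer x x) \<in> borel_measurable borel"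
proof -
  have "continuous_on UNIV (\<lambda>x::real ^ 'd. outer x x)"
    unfolding outer_def by (intro continuous_intros)
  then show ?thesis
    by (rule borel_measurable_continuous_onI)
qed

section \<open>Consequences of isotropy and independence\<close>

text \<open>A diagonal entry of the fourth-moment identity reads \<open>c = E \<parallel>x\<parallel>\<^sup>2 x\<^sub>i\<^sup>2 \<ge> E x\<^sub>i\<^sup>4\<close>, and
  \<open>x\<^sub>i\<^sup>4 \<ge> 2 x\<^sub>i\<^sup>2 - 1\<close> has expectation at least \<open>1\<close> because \<open>E x\<^sub>i\<^sup>2 = 1\<close>.\<close>

lemma isotropic_const_ge_1:
  fixes D :: "(real ^ 'd) measure"
  assumes D: "prob_space D" and iso: "isotropic D c"
  shows "c \<ge> 1"
proof -
  interpret D: prob_space D by fact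
  fix i :: 'd
  have entry: "bounded_linear (\<lambda>B :: real ^ 'd ^ 'd. B $ i $ i)"
    by (rule bounded_linear_compose[OF bounded_linear_vec_nth bounded_linear_vec_nth])
  note int = iso[unfolded isotropic_def]
  have i2: "integrable D (\<lambda>x. (x $ i)\<^sup>2)"
    and i4: "integrable D (\<lambda>x. (norm x)\<^sup>2 * (x $ i)\<^sup>2)"
    using integrable_bounded_linear[OF entry, of D "\<lambda>x. outer x x"]
      integrable_bounded_linear[OF entry, of D "\<lambda>x. (norm x)\<^sup>2 *\<^sub>R outer x x"] int
    by (simp_all add: outer_def power2_eq_square)
  have e2: "(\<integral>x. (x $ i)\<^sup>2 \<partial>D) = 1"
    and e4: "(\<integral>x. (norm x)\<^sup>2 * (x $ i)\<^sup>2 \<partial>D) = c"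
    using integral_bounded_linear[OF entry, of D "\<lambda>x. outer x x"]
      integral_bounded_linear[OF entry, of D "\<lambda>x. (norm x)\<^sup>2 *\<^sub>R outer x x"] int
    by (simp_all add: outer_def power2_eq_square mat_def)
  have "2 * (x $ i)\<^sup>2 - 1 \<le> (norm x)\<^sup>2 * (x $ i)\<^sup>2" for x :: "real ^ 'd"
  proof -
    have "(x $ i)\<^sup>2 \<le> (norm x)\<^sup>2"
      using component_le_norm_cart[of x i] by (simp add: abs_le_square_iff[symmetric])
    then have "(x $ i)\<^sup>2 * (x $ i)\<^sup>2 \<le> (norm x)\<^sup>2 * (x $ i)\<^sup>2"
      by (rule mult_right_mono) simp
    moreover have "0 \<le> ((x $ i)\<^sup>2 - 1)\<^sup>2" by simp
    ultimately show ?thesis by (simp add: power2_eq_square algebra_simps)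
  qed
  then have "(\<integral>x. 2 * (x $ i)\<^sup>2 - 1 \<partial>D) \<le> (\<integral>x. (norm x)\<^sup>2 * (x $ i)\<^sup>2 \<partial>D)"
    using i2 i4 by (intro integral_mono) auto
  then show ?thesis
    using i2 by (simp add: e2 e4 D.prob_space)
qed

text \<open>By independence, the expectation may be taken over \<open>X\<close> first, which replaces \<open>H\<close> by
  \<open>a I\<close> in the quadratic form. Entrywise this is the product rule for \<open>G\<^sub>i G\<^sub>j\<close> and \<open>H\<^sub>i\<^sub>j\<close>, where
  \<open>G\<^sub>i G\<^sub>j\<close> is integrable as it is dominated by \<open>\<parallel>G\<parallel>\<^sup>2\<close>; thus second moments of \<open>G\<close> and first
  moments of \<open>H\<close> suffice for the form to be integrable.\<close>

lemma (in prob_space) indep_quadratic_form: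
  fixes G X :: "'a \<Rightarrow> real ^ 'd" and h :: "real ^ 'd \<Rightarrow> real ^ 'd ^ 'd"
  defines "H \<equiv> \<lambda>\<omega>. h (X \<omega>)"
  assumes ind: "indep_var borel G borel X"
    and h: "h \<in> borel_measurable borel"
    and G2: "integrable M (\<lambda>\<omega>. (norm (G \<omega>))\<^sup>2)"
    and H: "integrable M H" and EH: "expectation H = a *\<^sub>R mat 1"
  shows "has_bochner_integral M (\<lambda>\<omega>. G \<omega> \<bullet> (H \<omega> *v G \<omega>)) (a * expectation (\<lambda>\<omega>. (norm (G \<omega>))\<^sup>2))"
proof -
  have mG: "G \<in> borel_measurable M"
    using indep_var_rv1[OF ind] .
  have [measurable]: "(\<lambda>\<omega>. G \<omega> $ i) \<in> borel_measurable M" for i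
    by (rule borel_measurable_continuous_on[OF linear_continuous_on[OF bounded_linear_vec_nth] mG])
  have GG: "integrable M (\<lambda>\<omega>. G \<omega> $ i * G \<omega> $ j)" for i j
  proof (rule Bochner_Integration.integrable_bound[OF G2])
    show "(\<lambda>\<omega>. G \<omega> $ i * G \<omega> $ j) \<in> borel_measurable M"
      by measurable
    have "\<bar>y $ i\<bar> * \<bar>y $ j\<bar> \<le> (norm y)\<^sup>2" for y :: "real ^ 'd"
      unfolding power2_eq_square by (intro mult_mono component_le_norm_cart) auto
    then show "AE \<omega> in M. norm (G \<omega> $ i * G \<omega> $ j) \<le> norm ((norm (G \<omega>))\<^sup>2)"
      by (simp add: abs_mult)
  qed
  have entry: "bounded_linear (\<lambda>B :: real ^ 'd ^ 'd. B $ i $ j)" for i j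
    by (rule bounded_linear_compose[OF bounded_linear_vec_nth bounded_linear_vec_nth])
  have Hij: "integrable M (\<lambda>\<omega>. H \<omega> $ i $ j)"
    and EHij: "expectation (\<lambda>\<omega>. H \<omega> $ i $ j) = (if i = j then a else 0)" for i j
    using integrable_bounded_linear[OF entry H] integral_bounded_linear[OF entry H, of i j] EH
    by (simp_all add: mat_def)
  have ind_ij: "indep_var borel (\<lambda>\<omega>. G \<omega> $ i * G \<omega> $ j) borel (\<lambda>\<omega>. H \<omega> $ i $ j)" for i j
    using indep_var_compose[OF ind, of "\<lambda>y. y $ i * y $ j" borel "\<lambda>x. h x $ i $ j" borel]
      measurable_compose[OF h borel_measurable_continuous_onI[OF linear_continuous_on[OF entry]]]
    by (simp add: o_def H_def)
  have "has_bochner_integral M (\<lambda>\<omega>. (G \<omega> $ i * G \<omega> $ j) * H \<omega> $ i $ j)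
      (expectation (\<lambda>\<omega>. G \<omega> $ i * G \<omega> $ j) * (if i = j then a else 0))" for i j
    using indep_var_integrable[OF ind_ij GG Hij]
      indep_var_lebesgue_integral[OF ind_ij GG Hij]
    by (simp only: has_bochner_integral_iff EHij)
  then have "has_bochner_integral M (\<lambda>\<omega>. \<Sum>i\<in>UNIV. \<Sum>j\<in>UNIV. (G \<omega> $ i * G \<omega> $ j) * H \<omega> $ i $ j)
      (\<Sum>i\<in>UNIV. \<Sum>j\<in>UNIV. expectation (\<lambda>\<omega>. G \<omega> $ i * G \<omega> $ j) * (if i = j then a else 0))"
    by (intro has_bochner_integral_sum)
  moreover have "(\<Sum>i\<in>UNIV. \<Sum>j\<in>UNIV. (G \<omega> $ i * G \<omega> $ j) * H \<omega> $ i $ j)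
      = G \<omega> \<bullet> (H \<omega> *v G \<omega>)" for \<omega>
    by (simp add: inner_vec_def matrix_vector_mult_def sum_distrib_left mult_ac)
  moreover have "(\<Sum>i\<in>UNIV. \<Sum>j\<in>UNIV. expectation (\<lambda>\<omega>. G \<omega> $ i * G \<omega> $ j) * (if i = j then a else 0))
      = a * expectation (\<lambda>\<omega>. (norm (G \<omega>))\<^sup>2)"
  proof -
    have "(\<Sum>i\<in>UNIV. \<Sum>j\<in>UNIV. expectation (\<lambda>\<omega>. G \<omega> $ i * G \<omega> $ j) * (if i = j then a else 0))
        = a * (\<Sum>i\<in>UNIV. expectation (\<lambda>\<omega>. G \<omega> $ i * G \<omega> $ i))"
      by (simp add: if_distrib sum.delta sum_distrib_left mult_ac cong: if_cong)
    also have "(\<Sum>i\<in>UNIV. expectation (\<lambda>\<omega>. G \<omega> $ i * G \<omega> $ i))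
        = expectation (\<lambda>\<omega>. \<Sum>i\<in>UNIV. G \<omega> $ i * G \<omega> $ i)"
      using GG by (simp add: Bochner_Integration.integral_sum)
    finally show ?thesis
      by (simp add: power2_norm_eq_inner inner_vec_def)
  qed
  ultimately show ?thesis by simp
qed

section \<open>Expected decrease of the residual\<close>

lemma residual_step_bound:
  fixes A :: "real ^ 'd ^ 'm" and v x :: "real ^ 'd" and b :: "real ^ 'm" and t :: real
  defines "g \<equiv> transpose A *v (A *v v - b)"
  shows "(norm (A *v (v - (t * ((A *v v - b) \<bullet> (A *v x))) *\<^sub>R x) - b))\<^sup>2
    \<le> (norm (A *v v - b))\<^sup>2 - 2 * t * (g \<bullet> x)\<^sup>2
       + t\<^sup>2 * (spectral_norm A)\<^sup>2 * ((norm x)\<^sup>2 * (g \<bullet> x)\<^sup>2)"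
proof -
  define r where "r = A *v v - b"
  have gx: "r \<bullet> (A *v x) = g \<bullet> x"
    unfolding g_def r_def by (rule inner_transpose_mult[symmetric])
  have "A *v (v - (t * ((A *v v - b) \<bullet> (A *v x))) *\<^sub>R x) - b = r - (t * (g \<bullet> x)) *\<^sub>R (A *v x)"
    using gx unfolding r_def
    by (simp add: matrix_vector_mult_diff_distrib scaleR_matrix_vector_assoc
        matrix_vector_mult_scaleR)
  also have "(norm (r - (t * (g \<bullet> x)) *\<^sub>R (A *v x)))\<^sup>2
      = (norm r)\<^sup>2 - 2 * t * (g \<bullet> x)\<^sup>2 + t\<^sup>2 * (g \<bullet> x)\<^sup>2 * (norm (A *v x))\<^sup>2"
    unfolding power2_norm_eq_inner
    by (simp add: inner_diff inner_commute[of "A *v x" r] gx power2_eq_square algebra_simps)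
  also have "t\<^sup>2 * (g \<bullet> x)\<^sup>2 * (norm (A *v x))\<^sup>2
      \<le> t\<^sup>2 * (g \<bullet> x)\<^sup>2 * (spectral_norm A * norm x)\<^sup>2"
    by (intro mult_left_mono power_mono norm_matrix_vector_le_spectral) auto
  finally show ?thesis
    by (simp add: r_def power_mult_distrib mult_ac)
qed

lemma (in prob_space) expected_residual_step:
  fixes V X :: "'a \<Rightarrow> real ^ 'd" and A :: "real ^ 'd ^ 'm" and b :: "real ^ 'm" and t :: real
  defines "V' \<equiv> \<lambda>\<omega>. V \<omega> - (t * ((A *v V \<omega> - b) \<bullet> (A *v X \<omega>))) *\<^sub>R X \<omega>"
    and "g \<equiv> \<lambda>\<omega>. transpose A *v (A *v V \<omega> - b)"
  assumes ind: "indep_var borel V borel X"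
    and iso: "isotropic (distr M borel X) c"
    and res: "integrable M (\<lambda>\<omega>. (norm (A *v V \<omega> - b))\<^sup>2)"
  shows "integrable M (\<lambda>\<omega>. (norm (g \<omega>))\<^sup>2)"
    and "integrable M (\<lambda>\<omega>. (norm (A *v V' \<omega> - b))\<^sup>2)"
    and "expectation (\<lambda>\<omega>. (norm (A *v V' \<omega> - b))\<^sup>2)
      \<le> expectation (\<lambda>\<omega>. (norm (A *v V \<omega> - b))\<^sup>2)
         - (2 * t - t\<^sup>2 * c * (spectral_norm A)\<^sup>2) * expectation (\<lambda>\<omega>. (norm (g \<omega>))\<^sup>2)"
proof -
  have [measurable]: "V \<in> borel_measurable M" "X \<in> borel_measurable M"
    using indep_var_rv1[OF ind] indep_var_rv2[OF ind] by auto
  have [measurable]: "V' \<in> borel_measurable M" "g \<in> borel_measurable M"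
    unfolding V'_def g_def by measurable
  show g2: "integrable M (\<lambda>\<omega>. (norm (g \<omega>))\<^sup>2)"
  proof (rule Bochner_Integration.integrable_bound)
    show "integrable M (\<lambda>\<omega>. (spectral_norm (transpose A))\<^sup>2 * (norm (A *v V \<omega> - b))\<^sup>2)"
      using res by simp
    have "(norm (g \<omega>))\<^sup>2 \<le> (spectral_norm (transpose A) * norm (A *v V \<omega> - b))\<^sup>2" for \<omega>
      unfolding g_def by (intro power_mono norm_matrix_vector_le_spectral) auto
    then show "AE \<omega> in M. norm ((norm (g \<omega>))\<^sup>2)
        \<le> norm ((spectral_norm (transpose A))\<^sup>2 * (norm (A *v V \<omega> - b))\<^sup>2)"
      by (simp add: power_mult_distrib)
  qed measurable
  have ind_g: "indep_var borel g borel X"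
  proof -
    have "(\<lambda>y. transpose A *v (A *v y - b)) \<in> borel_measurable borel"
      by measurable
    from indep_var_compose[OF ind this measurable_id] show ?thesis
      by (simp add: o_def id_def g_def)
  qed
  note D = iso[unfolded isotropic_def]
  have second: "has_bochner_integral M (\<lambda>\<omega>. g \<omega> \<bullet> (outer (X \<omega>) (X \<omega>) *v g \<omega>))
      (1 * expectation (\<lambda>\<omega>. (norm (g \<omega>))\<^sup>2))"
    using D by (intro indep_quadratic_form[OF ind_g, where h = "\<lambda>x. outer x x"] g2)
       (simp_all add: integrable_distr_eq integral_distr)
  have fourth: "has_bochner_integral M
      (\<lambda>\<omega>. g \<omega> \<bullet> (((norm (X \<omega>))\<^sup>2 *\<^sub>R outer (X \<omega>) (X \<omega>)) *v g \<omega>))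
      (c * expectation (\<lambda>\<omega>. (norm (g \<omega>))\<^sup>2))"
    using D by (intro indep_quadratic_form[OF ind_g, where h = "\<lambda>x. (norm x)\<^sup>2 *\<^sub>R outer x x"] g2)
       (simp_all add: integrable_distr_eq integral_distr)
  let ?bound = "\<lambda>\<omega>. (norm (A *v V \<omega> - b))\<^sup>2 - 2 * t * (g \<omega> \<bullet> X \<omega>)\<^sup>2
      + t\<^sup>2 * (spectral_norm A)\<^sup>2 * ((norm (X \<omega>))\<^sup>2 * (g \<omega> \<bullet> X \<omega>)\<^sup>2)"
  have bound: "has_bochner_integral M ?bound
      (expectation (\<lambda>\<omega>. (norm (A *v V \<omega> - b))\<^sup>2)
        - 2 * t * (1 * expectation (\<lambda>\<omega>. (norm (g \<omega>))\<^sup>2))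
        + t\<^sup>2 * (spectral_norm A)\<^sup>2 * (c * expectation (\<lambda>\<omega>. (norm (g \<omega>))\<^sup>2)))"
    using second fourth res
    by (intro has_bochner_integral_add has_bochner_integral_diff has_bochner_integral_mult_right)
       (simp_all add: outer_quadratic_form scaleR_matrix_vector_assoc[symmetric]
         has_bochner_integral_integrable)
  have le: "(norm (A *v V' \<omega> - b))\<^sup>2 \<le> ?bound \<omega>" for \<omega>
    unfolding V'_def g_def by (rule residual_step_bound)
  show res': "integrable M (\<lambda>\<omega>. (norm (A *v V' \<omega> - b))\<^sup>2)"
  proof (rule Bochner_Integration.integrable_bound)
    show "integrable M ?bound"
      using bound by (simp add: has_bochner_integral_iff)
    show "AE \<omega> in M. norm ((norm (A *v V' \<omega> - b))\<^sup>2) \<le> norm (?bound \<omega>)"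
      using order_trans[OF le abs_ge_self] by simp
  qed measurable
  have "expectation (\<lambda>\<omega>. (norm (A *v V' \<omega> - b))\<^sup>2) \<le> expectation ?bound"
    using res' bound le by (intro integral_mono) (auto simp: has_bochner_integral_iff)
  then show "expectation (\<lambda>\<omega>. (norm (A *v V' \<omega> - b))\<^sup>2)
      \<le> expectation (\<lambda>\<omega>. (norm (A *v V \<omega> - b))\<^sup>2)
         - (2 * t - t\<^sup>2 * c * (spectral_norm A)\<^sup>2) * expectation (\<lambda>\<omega>. (norm (g \<omega>))\<^sup>2)"
    using bound by (simp add: has_bochner_integral_iff algebra_simps)
qed

section \<open>Independence of iterate and direction\<close>

lemma sgdas_cong:
  assumes "\<And>j. j < k \<Longrightarrow> x j = y j"
  shows "sgdas A b \<tau> x k = sgdas A b \<tau> y k"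
  using assms by (induction k) simp_all

lemma measurable_sgdas:
  assumes "{..<k} \<subseteq> J"
  shows "(\<lambda>x. sgdas A b \<tau> x k) \<in> borel_measurable (Pi\<^sub>M J (\<lambda>_. borel))"
  using assms
proof (induction k)
  case (Suc k)
  then have k: "k \<in> J" and "{..<k} \<subseteq> J"
    by auto
  with Suc.IH have [measurable]: "(\<lambda>x. sgdas A b \<tau> x k) \<in> borel_measurable (Pi\<^sub>M J (\<lambda>_. borel))"
    by blast
  have [measurable]: "(\<lambda>x. x k) \<in> borel_measurable (Pi\<^sub>M J (\<lambda>_. borel))"
    using k by measurable
  show ?case by simp
qed simp

text \<open>The \<open>k\<close>-th iterate is a function of the directions with index below \<open>k\<close> only.\<close>

lemma (in prob_space) indep_var_sgdas:
  assumes "indep_vars (\<lambda>_. borel) X UNIV"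
  shows "indep_var borel (\<lambda>\<omega>. sgdas A b \<tau> (\<lambda>j. X j \<omega>) k) borel (X k)"
proof -
  have "indep_var borel ((\<lambda>x. sgdas A b \<tau> x k) \<circ> (\<lambda>\<omega>. restrict (\<lambda>j. X j \<omega>) {..<k}))
      borel ((\<lambda>x. x k) \<circ> (\<lambda>\<omega>. restrict (\<lambda>j. X j \<omega>) {k}))"
    by (intro indep_var_compose[OF indep_var_restrict[OF assms]] measurable_sgdas) auto
  moreover have "(\<lambda>x. sgdas A b \<tau> x k) \<circ> (\<lambda>\<omega>. restrict (\<lambda>j. X j \<omega>) {..<k})
      = (\<lambda>\<omega>. sgdas A b \<tau> (\<lambda>j. X j \<omega>) k)"
    by (auto simp: o_def fun_eq_iff intro: sgdas_cong)
  moreover have "(\<lambda>x. x k) \<circ> (\<lambda>\<omega>. restrict (\<lambda>j. X j \<omega>) {k}) = X k"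
    by auto
  ultimately show ?thesis by simp
qed

section \<open>The convergence rate\<close>

theorem theorem3p8:
  fixes M :: "'w measure"
    and X :: "nat \<Rightarrow> 'w \<Rightarrow> real ^ 'd"
    and D :: "(real ^ 'd) measure"
    and A :: "real ^ 'd ^ 'm"
    and b :: "real ^ 'm"
    and c \<tau> :: real
    and v :: "nat \<Rightarrow> 'w \<Rightarrow> real ^ 'd"
    and N :: nat
  assumes "prob_space M"
    and "prob_space.indep_vars M (\<lambda>_. borel) X UNIV"
    and "\<And>k. distr M borel (X k) = D"
    and "isotropic D c"
    and "A \<noteq> 0"
    and "\<tau> = 1 / (c * (spectral_norm A)\<^sup>2)"
    and "\<And>k \<omega>. v k \<omega> = sgdas A b (\<lambda>_. \<tau>) (\<lambda>j. X j \<omega>) k"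
    and "N \<ge> 1"
  shows "(\<forall>k. integrable M (\<lambda>\<omega>. (norm (transpose A *v (A *v v k \<omega> - b)))\<^sup>2)) \<and>
    (MIN k\<in>{0..N - 1}. integral\<^sup>L M (\<lambda>\<omega>. (norm (transpose A *v (A *v v k \<omega> - b)))\<^sup>2))
      \<le> c * (spectral_norm A)\<^sup>2 * (norm b)\<^sup>2 / real N"
proof -
  interpret prob_space M by fact
  define R where "R = (\<lambda>k \<omega>. (norm (A *v v k \<omega> - b))\<^sup>2)"
  define G where "G = (\<lambda>k \<omega>. (norm (transpose A *v (A *v v k \<omega> - b)))\<^sup>2)"
  have v0: "v 0 \<omega> = 0"
    and vSuc: "v (Suc k) \<omega> = v k \<omega> - (\<tau> * ((A *v v k \<omega> - b) \<bullet> (A *v X k \<omega>))) *\<^sub>R X k \<omega>" for k \<omega>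
    by (simp_all add: assms(7))
  have ind: "indep_var borel (v k) borel (X k)" for k
    using indep_var_sgdas[OF assms(2), of A b "\<lambda>_. \<tau>" k] by (simp add: assms(7)[abs_def])
  have iso: "isotropic (distr M borel (X k)) c" for k
    using assms(3,4) by simp
  have "prob_space D"
    using prob_space_distr[OF indep_var_rv2[OF ind[of 0]]] assms(3) by simp
  from isotropic_const_ge_1[OF this assms(4)] have L: "c * (spectral_norm A)\<^sup>2 > 0"
    using spectral_norm_pos[OF assms(5)] by simp
  then have \<tau>: "\<tau> > 0"
    by (simp add: assms(6))
  have gain: "2 * \<tau> - \<tau>\<^sup>2 * c * (spectral_norm A)\<^sup>2 = \<tau>"
    using L by (simp add: assms(6) power2_eq_square field_simps)

  have intR: "integrable M (R k)" for k
  proof (induction k)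
    case 0
    show ?case by (simp add: R_def v0)
  next
    case (Suc k)
    then show ?case
      using expected_residual_step(2)[OF ind iso, where A = A and b = b and t = \<tau>] by (simp add: R_def vSuc)
  qed
  have intG: "integrable M (G k)" for k
    using expected_residual_step(1)[OF ind iso, where A = A and b = b] intR[of k] by (simp add: R_def G_def)
  have drop: "expectation (R (Suc k)) \<le> expectation (R k) - \<tau> * expectation (G k)" for k
    using expected_residual_step(3)[OF ind iso, where A = A and b = b and t = \<tau>] intR[of k] gain
    by (simp add: R_def G_def vSuc)
  have "\<tau> * (\<Sum>k<n. expectation (G k)) \<le> (norm b)\<^sup>2 - expectation (R n)" for n
  proof (induction n)
    case 0
    show ?case by (simp add: R_def v0 prob_space)
  next
    case (Suc n)
    then show ?case using drop[of n] by (simp add: algebra_simps)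
  qed
  moreover have "expectation (R N) \<ge> 0"
    unfolding R_def by (rule Bochner_Integration.integral_nonneg) simp
  ultimately have sum_le: "\<tau> * (\<Sum>k<N. expectation (G k)) \<le> (norm b)\<^sup>2"
    by (smt (verit))
  let ?m = "MIN k\<in>{0..N - 1}. expectation (G k)"
  have "real N * ?m = (\<Sum>k<N. ?m)"
    by simp
  also have "\<dots> \<le> (\<Sum>k<N. expectation (G k))"
    by (intro sum_mono Min_le) auto
  also have "\<dots> \<le> (norm b)\<^sup>2 / \<tau>"
    using sum_le \<tau> by (simp add: field_simps)
  also have "\<dots> = c * (spectral_norm A)\<^sup>2 * (norm b)\<^sup>2"
    by (simp add: assms(6))
  finally have "?m \<le> c * (spectral_norm A)\<^sup>2 * (norm b)\<^sup>2 / real N"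
    using assms(8) by (simp add: field_simps)
  then show ?thesis
    using intG by (simp add: G_def)
qed

end
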